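(* Let $d\ge 1$ and let $\Phi$ be a minimal balanced family of $2$-element subsets of $[d]=\{1,\dots,d\}$. Then $[d]$ is a disjoint union of subsets $I_1,\dots,I_k$, and $\Phi=\Phi_1\cup\dots\cup\Phi_k$, where for each $\ell=1,\dots,k$ the family $\Phi_\ell$ consists of $2$-element subsets of $I_\ell$ and is either cyclic of odd size with respect to $I_\ell$, or isolated with respect to $I_\ell$ (that is, $|I_\ell|=2$ and $\Phi_\ell=\{I_\ell\}$).
   Context: A family $\Phi=\{S_1,\dots,S_m\}$ of (distinct) subsets of $[d]$ is called balanced if there are non-negative real weights $w_1,\dots,w_m$ such that $\sum_{k=1}^m w_k\eta_k=(1,\dots,1)\in\mathbb{R}^d$, where $\eta_k\in\{0,1\}^d$ is the characteristic (indicator) vector of $S_k$ in $[d]$. A balanced family is called minimal if it has no proper balanced subfamily. Let $I=\{i_1,\dots,i_n\}$ be a finite set with $n$ elements. If $n\ge 3$, a family $F$ of $2$-element subsets of $I$ is called cyclic with respect to $I$ if, for some ordering $i_1,\dots,i_n$ of the elements of $I$, $F=\{\{i_1,i_2\},\{i_2,i_3\},\dots,\{i_{n-1},i_n\},\{i_n,i_1\}\}$. If $n=2$, the family $F=\{\{i_1,i_2\}\}$ is called isolated. A family is of odd size if it contains an odd number of subsets. *)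

theory Defs
  imports Complex_Main "HOL-Library.Indicator_Function" "HOL-Library.Disjoint_Sets"
    "HOL-Library.Ramsey"
begin

text \<open>
  Since a family is a set of distinct subsets, its weights are given by a function on the subsets.
  Vectors in \<open>d\<close>-dimensional real space are functions on \<open>{1..d}\<close>, compared coordinate by coordinate.
\<close>

definition balanced_family :: "nat \<Rightarrow> nat set set \<Rightarrow> bool" where
  "balanced_family d \<Phi> \<longleftrightarrow>
     \<Phi> \<subseteq> Pow {1..d} \<and>
     (\<exists>w :: nat set \<Rightarrow> real.
        (\<forall>S\<in>\<Phi>. w S \<ge> 0) \<and>
        (\<forall>i\<in>{1..d}. (\<Sum>S\<in>\<Phi>. w S * indicator S i) = 1))"

definition minimal_balanced_family :: "nat \<Rightarrow> nat set set \<Rightarrow> bool" where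
  "minimal_balanced_family d \<Phi> \<longleftrightarrow>
     balanced_family d \<Phi> \<and> \<not> (\<exists>\<Psi>. \<Psi> \<subset> \<Phi> \<and> balanced_family d \<Psi>)"

definition cyclic_family :: "'a set \<Rightarrow> 'a set set \<Rightarrow> bool" where
  "cyclic_family I F \<longleftrightarrow>
     finite I \<and> card I \<ge> 3 \<and>
     (\<exists>f :: nat \<Rightarrow> 'a. bij_betw f {1..card I} I \<and>
        F = {{f j, f (j + 1)} | j. 1 \<le> j \<and> j < card I} \<union> {{f (card I), f 1}})"

definition isolated_family :: "'a set \<Rightarrow> 'a set set \<Rightarrow> bool" where
  "isolated_family I F \<longleftrightarrow> finite I \<and> card I = 2 \<and> F = {I}"

end

theory Submission
  imports Defs
begin

text \<open>
  Minimality forces the incidence matrix of \<open>\<Phi>\<close> to have trivial kernel: moving the weights along a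
  kernel vector until the first one vanishes would produce a smaller balanced family. An edge of
  weight 1 meets no other edge, so it is isolated. On a union of connected components without such an
  edge every vertex has degree at least 2, while the trivial kernel allows at most as many edges as
  vertices. Hence every degree is exactly 2, and a non-backtracking walk closes up to a cycle that
  no other edge meets. An even cycle would carry an alternating kernel vector.
\<close>

section \<open>Homogeneous linear systems with more unknowns than equations\<close>

text \<open>Gaussian elimination, one row at a time: a zero row imposes nothing, and otherwise a
  nonzero coefficient of row \<open>i\<close> serves as pivot. Removing that row and the pivot
  unknown keeps the strict inequality of cardinalities.\<close>

lemma underdetermined_system:
  fixes A :: "'i \<Rightarrow> 'e \<Rightarrow> 'f::field"
  assumes "finite I" "finite E" "card I < card E"
  shows "\<exists>u. (\<exists>e\<in>E. u e \<noteq> 0) \<and> (\<forall>i\<in>I. (\<Sum>e\<in>E. A i e * u e) = 0)"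
  using assms
proof (induction I arbitrary: E A rule: finite_induct)
  case empty
  then have "E \<noteq> {}" by auto
  then show ?case by (intro exI[of _ "\<lambda>_. 1"]) auto
next
  case (insert i I)
  show ?case
  proof (cases "\<forall>e\<in>E. A i e = 0")
    case True
    have "card I < card E" using insert by simp
    from insert.IH[OF insert.prems(1) this, of A] True show ?thesis by fastforce
  next
    case False
    then obtain e0 where e0: "e0 \<in> E" "A i e0 \<noteq> 0" by blast
    define E' where "E' = E - {e0}"
    have E': "finite E'" "card I < card E'"
      using insert e0 by (auto simp: E'_def)
    obtain u where u: "\<exists>e\<in>E'. u e \<noteq> 0"
      "\<And>j. j \<in> I \<Longrightarrow> (\<Sum>e\<in>E'. (A j e - A j e0 * A i e / A i e0) * u e) = 0"
      using insert.IH[OF E', of "\<lambda>j e. A j e - A j e0 * A i e / A i e0"] by blast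
    define s where "s = (\<Sum>e\<in>E'. A i e * u e)"
    \<comment> \<open>The pivot unknown is not in \<open>E'\<close>, so its value is still free;
      this one solves row \<open>i\<close>.\<close>
    define u' where "u' = u(e0 := - s / A i e0)"
    have split: "(\<Sum>e\<in>E. A j e * u' e) = - (A j e0 * s / A i e0) + (\<Sum>e\<in>E'. A j e * u e)" for j
    proof -
      have "(\<Sum>e\<in>E'. A j e * u' e) = (\<Sum>e\<in>E'. A j e * u e)"
        by (rule sum.cong) (auto simp: u'_def E'_def)
      then show ?thesis
        using sum.remove[OF insert.prems(1) e0(1), of "\<lambda>e. A j e * u' e"]
        by (simp add: E'_def u'_def)
    qed
    have "(\<Sum>e\<in>E. A j e * u' e) = 0" if "j \<in> insert i I" for j
    proof (cases "j = i")
      case True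
      then show ?thesis using split[of i] e0 by (simp add: s_def)
    next
      case False
      then have "(\<Sum>e\<in>E'. A j e * u e) - A j e0 / A i e0 * s = 0"
        using u(2)[of j] that
        by (simp add: s_def sum_distrib_left sum_subtractf algebra_simps)
      then show ?thesis using split[of j] by (simp add: algebra_simps)
    qed
    moreover have "\<exists>e\<in>E. u' e \<noteq> 0"
      using u(1) by (auto simp: u'_def E'_def)
    ultimately show ?thesis by blast
  qed
qed

section \<open>Walks and cycles in graphs given by edge sets\<close>

lemma nsets_2_other_end:
  assumes "S \<in> nsets U 2" "x \<in> S"
  obtains y where "y \<noteq> x" "y \<in> U" "S = {x, y}"
proof -
  obtain a b where "S = {a, b}" "a \<noteq> b" "S \<subseteq> U"
    using assms(1) by (auto simp: nsets_def card_2_iff)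
  with assms(2) that[of a] that[of b] show thesis by (auto simp: insert_commute)
qed

lemma non_backtracking_walk:
  assumes E: "E \<subseteq> nsets U 2" and "finite E"
    and deg: "\<And>x. x \<in> U \<Longrightarrow> 2 \<le> card {S \<in> E. x \<in> S}"
    and "v \<in> U"
  obtains f :: "nat \<Rightarrow> 'a" where "f 0 = v"
    "\<And>n. {f n, f (Suc n)} \<in> E" "\<And>n. f (Suc (Suc n)) \<noteq> f n"
proof -
  have step: "\<exists>z. z \<noteq> x \<and> {y, z} \<in> E" if "y \<in> U" for x y
  proof -
    \<comment> \<open>Of the at least two edges at \<open>y\<close>, only \<open>{x, y}\<close>
      leads back to \<open>x\<close>.\<close>
    have "\<not> {S \<in> E. y \<in> S} \<subseteq> {{x, y}}"
      using deg[OF that] card_mono[of "{{x, y}}" "{S \<in> E. y \<in> S}"] by auto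
    then obtain S where S: "S \<in> E" "y \<in> S" "S \<noteq> {x, y}" by blast
    then obtain z where "S = {y, z}" using E nsets_2_other_end by (metis subsetD)
    with S show ?thesis by (auto simp: insert_commute)
  qed
  have inU: "y \<in> U" if "{x, y} \<in> E" for x y
    using that E by (auto simp: nsets_def)
  \<comment> \<open>Dependent choice runs over pairs of consecutive vertices, because the next
    vertex has to avoid the one before the current one.\<close>
  have "\<exists>p. \<forall>n::nat. (({fst (p n), snd (p n)} \<in> E) \<and> (n = 0 \<longrightarrow> fst (p n) = v)) \<and>
      (fst (p (Suc n)) = snd (p n) \<and> snd (p (Suc n)) \<noteq> fst (p n))"
  proof (rule dependent_nat_choice)
    show "\<exists>q. {fst q, snd q} \<in> E \<and> ((0::nat) = 0 \<longrightarrow> fst q = v)"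
      using step[OF \<open>v \<in> U\<close>] by fastforce
  next
    fix q and n :: nat
    assume "{fst q, snd q} \<in> E \<and> (n = 0 \<longrightarrow> fst q = v)"
    then obtain z where "z \<noteq> fst q" "{snd q, z} \<in> E"
      using step[of "snd q" "fst q"] inU by blast
    then show "\<exists>r. ({fst r, snd r} \<in> E \<and> (Suc n = 0 \<longrightarrow> fst r = v)) \<and>
        fst r = snd q \<and> snd r \<noteq> fst q"
      by (intro exI[of _ "(snd q, z)"]) auto
  qed
  then obtain p where p: "\<And>n::nat. {fst (p n), snd (p n)} \<in> E" "fst (p 0) = v"
    "\<And>n. fst (p (Suc n)) = snd (p n)" "\<And>n. snd (p (Suc n)) \<noteq> fst (p n)"
    by blast
  show thesis
    by (rule that[of "\<lambda>n. fst (p n)"]) (use p in auto)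
qed

text \<open>A non-backtracking walk in a finite graph must repeat a vertex, and with all degrees
  equal to 2 the first repetition can only be at its start. Each vertex of the resulting cycle has
  both of its edges on the cycle, so no further edge of \<open>E\<close> touches it.\<close>

lemma two_regular_cycle:
  assumes "finite U" and E: "E \<subseteq> nsets U 2"
    and deg: "\<And>x. x \<in> U \<Longrightarrow> card {S \<in> E. x \<in> S} = 2"
    and "v \<in> U"
  obtains n and f :: "nat \<Rightarrow> 'a" where
    "n \<ge> 3" "f n = f 0" "inj_on f {..<n}" "f ` {..<n} \<subseteq> U"
    "inj_on (\<lambda>j. {f j, f (Suc j)}) {..<n}"
    "{S \<in> E. S \<inter> f ` {..<n} \<noteq> {}} = (\<lambda>j. {f j, f (Suc j)}) ` {..<n}"
proof -
  have "finite E" using finite_subset[OF E] \<open>finite U\<close> finite_imp_finite_nsets by blast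
  obtain f where f: "f 0 = v" "\<And>n. {f n, f (Suc n)} \<in> E" "\<And>n. f (Suc (Suc n)) \<noteq> f n"
    using non_backtracking_walk[OF E \<open>finite E\<close> _ \<open>v \<in> U\<close>] deg by (metis order_refl)
  define e where "e = (\<lambda>j. {f j, f (Suc j)})"
  have eE: "e j \<in> E" for j using f(2) by (simp add: e_def)
  have fU: "f j \<in> U" for j using f(2)[of j] E by (auto simp: nsets_def)
  have neq: "f (Suc j) \<noteq> f j" for j using f(2)[of j] E by (auto simp: nsets_def)
  have "\<exists>n. \<not> inj_on f {..n}"
  proof (rule ccontr)
    assume "\<not> (\<exists>n. \<not> inj_on f {..n})"
    then have "card {..card U} \<le> card U"
      using fU by (intro card_inj_on_le[of f] \<open>finite U\<close>) auto
    then show False by simp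
  qed
  \<comment> \<open>The walk takes its first repeated value at time \<open>n\<close>.\<close>
  define n where "n = (LEAST n. \<not> inj_on f {..n})"
  have n: "\<not> inj_on f {..n}" unfolding n_def by (rule LeastI_ex) fact
  have min: "inj_on f {..m}" if "m < n" for m
    using not_less_Least that unfolding n_def by blast
  have inj: "inj_on f {..<n}"
    using min[of "n - 1"] by (cases n) (auto simp: lessThan_Suc_atMost)
  have inj_e: "inj_on e {..<n}"
  proof (rule linorder_inj_onI)
    fix j k assume jk: "j < k" "j \<in> {..<n}" "k \<in> {..<n}"
    show "e j \<noteq> e k"
    proof
      assume "e j = e k"
      \<comment> \<open>Equal edges would have to be traversed in opposite directions. Injectivity
        then makes them consecutive, which is backtracking.\<close>
      moreover have "f j \<noteq> f k" using inj jk by (metis inj_onD less_irrefl)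
      ultimately have *: "f j = f (Suc k)" "f (Suc j) = f k"
        by (auto simp: e_def doubleton_eq_iff)
      then have "Suc j = k" using inj jk by (auto dest: inj_onD)
      with * f(3)[of j] show False by simp
    qed
  qed auto
  obtain m where m: "m < n" "f m = f n"
  proof -
    have "{..n} = insert n {..<n}" by auto
    with n inj have "f n \<in> f ` {..<n}" by simp
    then show thesis using that by (metis imageE lessThan_iff)
  qed
  have "m = 0"
    \<comment> \<open>otherwise the edges with indices \<open>m - 1\<close>, \<open>m\<close> and \<open>n - 1\<close> all contain \<open>f m\<close>\<close>
  proof (rule ccontr)
    assume "m \<noteq> 0"
    then obtain l where l: "m = Suc l" by (cases m) auto
    obtain k where k: "n = Suc k" using m by (cases n) auto
    have "m \<noteq> k" using m neq k by metis
    then have "card (e ` {l, m, k}) = 3"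
      using l k m by (subst card_image[OF inj_on_subset[OF inj_e]]) auto
    moreover have "f m \<in> e l" "f m \<in> e m" "f m \<in> e k" using l k m by (auto simp: e_def)
    then have "e ` {l, m, k} \<subseteq> {S \<in> E. f m \<in> S}" using eE by blast
    ultimately show False
      using card_mono[of "{S \<in> E. f m \<in> S}" "e ` {l, m, k}"] deg[OF fU] \<open>finite E\<close> by simp
  qed
  have "n \<ge> 3"
  proof -
    \<comment> \<open>Length 1 would be a loop and length 2 an immediate return.\<close>
    have "n \<noteq> 1" "n \<noteq> 2" "n \<noteq> 0"
      using m \<open>m = 0\<close> neq[of 0] f(3)[of 0] by (auto simp: numeral_2_eq_2)
    then show ?thesis by linarith
  qed
  have star: "S \<in> e ` {..<n}" if "S \<in> E" "f j \<in> S" "j < n" for S j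
  proof -
    \<comment> \<open>The cyclic predecessor of \<open>j\<close>: \<open>e a\<close> and
      \<open>e j\<close> are the two cycle edges at \<open>f j\<close>.\<close>
    define a where "a = (if j = 0 then n - 1 else j - 1)"
    have a: "a < n" "a \<noteq> j" "f j \<in> e a"
      using that \<open>n \<ge> 3\<close> m \<open>m = 0\<close> by (auto simp: a_def e_def)
    have "e a \<noteq> e j" using inj_e a that by (auto dest: inj_onD)
    then have "card {e a, e j} = 2" by simp
    moreover have "{e a, e j} \<subseteq> {S \<in> E. f j \<in> S}"
      using eE a by (auto simp: e_def)
    ultimately have "{e a, e j} = {S \<in> E. f j \<in> S}"
      using deg[OF fU] \<open>finite E\<close> by (intro card_subset_eq) auto
    then show ?thesis using that a by auto
  qed
  have "{S \<in> E. S \<inter> f ` {..<n} \<noteq> {}} = e ` {..<n}"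
    using star eE by (auto simp: e_def)
  with that[of n f] \<open>n \<ge> 3\<close> m \<open>m = 0\<close> inj inj_e fU show thesis
    unfolding e_def by auto
qed

section \<open>Even cycles, and the link to \<open>cyclic_family\<close>\<close>

text \<open>Signs alternate along the closed walk, so consecutive edges cancel at their common
  vertex; even length makes the last and the first edge cancel as well.\<close>

lemma even_cycle_alternating_weights:
  assumes "finite \<Phi>" "even n" "n > 0" "f n = f 0"
    and neq: "\<And>j. j < n \<Longrightarrow> f (Suc j) \<noteq> f j"
    and inj: "inj_on (\<lambda>j. {f j, f (Suc j)}) {..<n}"
    and sub: "(\<lambda>j. {f j, f (Suc j)}) ` {..<n} \<subseteq> \<Phi>"
  obtains u :: "'a set \<Rightarrow> real" where "\<exists>S\<in>\<Phi>. u S \<noteq> 0"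
    "\<And>i. (\<Sum>S\<in>\<Phi>. u S * indicator S i) = 0"
proof -
  define e where "e = (\<lambda>j. {f j, f (Suc j)})"
  have inj_e: "inj_on e {..<n}" and sub_e: "e ` {..<n} \<subseteq> \<Phi>"
    using inj sub by (auto simp: e_def)
  \<comment> \<open>Since \<open>e\<close> is injective, \<open>inv_into\<close> recovers the
    position of an edge on the walk. Edges off the walk get 0.\<close>
  define u :: "'a set \<Rightarrow> real"
    where "u S = (if S \<in> e ` {..<n} then (-1) ^ inv_into {..<n} e S else 0)" for S
  have u: "u (e j) = (-1) ^ j" if "j < n" for j
    using that inj_e by (simp add: u_def)
  have "(\<Sum>S\<in>\<Phi>. u S * indicator S i) = 0" for i
  proof -
    let ?x = "\<lambda>j. indicator {i} (f j) :: real"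
    have "(\<Sum>S\<in>\<Phi>. u S * indicator S i) = (\<Sum>S\<in>e ` {..<n}. u S * indicator S i)"
      using sub_e \<open>finite \<Phi>\<close> by (intro sum.mono_neutral_right) (auto simp: u_def)
    also have "\<dots> = (\<Sum>j<n. u (e j) * indicator (e j) i)"
      using inj_e by (simp add: sum.reindex)
    \<comment> \<open>The indicator of an edge is the sum of those of its two distinct ends; the
      sign change turns this sum into a telescoping difference.\<close>
    also have "\<dots> = (\<Sum>j<n. (-1) ^ j * ?x j - (-1) ^ Suc j * ?x (Suc j))"
    proof (rule sum.cong)
      fix j assume "j \<in> {..<n}"
      then show "u (e j) * indicator (e j) i = (-1) ^ j * ?x j - (-1) ^ Suc j * ?x (Suc j)"
        using u[of j] neq[of j] by (auto simp: e_def indicator_def)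
    qed simp
    also have "\<dots> = 0"
      using \<open>even n\<close> \<open>f n = f 0\<close> by (subst sum_lessThan_telescope') simp
    finally show ?thesis .
  qed
  moreover have "\<exists>S\<in>\<Phi>. u S \<noteq> 0"
    using u[of 0] \<open>n > 0\<close> sub_e by (intro bexI[of _ "e 0"]) auto
  ultimately show thesis using that by blast
qed

text \<open>Shifts the indices from \<open>0..n-1\<close> to the \<open>1..n\<close> of the
  definition: as \<open>f n = f 0\<close>, the first edge of the walk becomes the closing edge
  \<open>{f n, f 1}\<close>.\<close>

lemma cyclic_family_closed_walk:
  assumes "n \<ge> 3" "f n = f 0" "inj_on f {..<n}"
  shows "cyclic_family (f ` {..<n}) ((\<lambda>j. {f j, f (Suc j)}) ` {..<n})"
proof -
  let ?I = "f ` {..<n}"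
  have card: "card ?I = n" using assms by (simp add: card_image)
  have img: "f ` {1..n} = ?I"
  proof -
    have "{1..n} = insert n {1..<n}" "{..<n} = insert 0 {1..<n}" using assms(1) by auto
    then show ?thesis using assms(2) by (metis image_insert)
  qed
  \<comment> \<open>A map from an \<open>n\<close>-element set onto an \<open>n\<close>-element set
    is injective.\<close>
  have "inj_on f {1..n}"
    by (rule eq_card_imp_inj_on) (simp_all only: img card finite_atLeastAtMost, simp)
  then have bij: "bij_betw f {1..n} ?I" using img by (simp add: bij_betw_def)
  have "{..<n} = insert 0 {1..<n}" using assms(1) by auto
  then have "(\<lambda>j. {f j, f (Suc j)}) ` {..<n} =
      insert {f 0, f (Suc 0)} ((\<lambda>j. {f j, f (Suc j)}) ` {1..<n})"
    by (simp only: image_insert)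
  also have "\<dots> = {{f j, f (j + 1)} |j. 1 \<le> j \<and> j < n} \<union> {{f n, f 1}}"
    unfolding assms(2) by auto
  finally have "(\<lambda>j. {f j, f (Suc j)}) ` {..<n} =
      {{f j, f (j + 1)} |j. 1 \<le> j \<and> j < n} \<union> {{f n, f 1}}" .
  then show ?thesis
    using bij assms(1) card unfolding cyclic_family_def card by blast
qed

section \<open>Minimality and the kernel of the incidence matrix\<close>

text \<open>It suffices to exclude negative entries, since \<open>- u\<close> is a kernel vector
  too; hence the inner claim is stated for arbitrary \<open>u\<close>.\<close>

lemma minimal_balanced_kernel_trivial:
  fixes u w :: "nat set \<Rightarrow> real"
  assumes min: "minimal_balanced_family d \<Phi>"
    and w: "\<And>S. S \<in> \<Phi> \<Longrightarrow> w S \<ge> 0"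
      "\<And>i. i \<in> {1..d} \<Longrightarrow> (\<Sum>S\<in>\<Phi>. w S * indicator S i) = 1"
    and u: "\<And>i. i \<in> {1..d} \<Longrightarrow> (\<Sum>S\<in>\<Phi>. u S * indicator S i) = 0"
    and "S \<in> \<Phi>"
  shows "u S = 0"
proof -
  have sub: "\<Phi> \<subseteq> Pow {1..d}"
    using min by (auto simp: minimal_balanced_family_def balanced_family_def)
  have fin: "finite \<Phi>" using sub finite_subset by blast
  have nonneg: "u T \<ge> 0"
    if u: "\<And>i. i \<in> {1..d} \<Longrightarrow> (\<Sum>S\<in>\<Phi>. u S * indicator S i) = 0" and T: "T \<in> \<Phi>"
    for T and u :: "nat set \<Rightarrow> real"
  proof (rule ccontr)
    assume "\<not> u T \<ge> 0"
    define N where "N = {S \<in> \<Phi>. u S < 0}"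
    have N: "finite N" "N \<noteq> {}" using fin T \<open>\<not> u T \<ge> 0\<close> by (auto simp: N_def)
    \<comment> \<open>The largest step for which all weights \<open>w S + t * u S\<close> stay
      nonnegative; at a minimizer \<open>S0\<close> the weight drops to 0.\<close>
    define t where "t = Min ((\<lambda>S. w S / - u S) ` N)"
    have "t \<in> (\<lambda>S. w S / - u S) ` N" unfolding t_def using N by (intro Min_in) auto
    then obtain S0 where S0: "S0 \<in> N" "t = w S0 / - u S0" by blast
    have "t \<ge> 0"
      unfolding S0(2) using S0(1) w(1)[of S0] by (intro divide_nonneg_pos) (auto simp: N_def)
    define w' where "w' S = w S + t * u S" for S
    have w'_pos: "w' S \<ge> 0" if "S \<in> \<Phi>" for S
    proof (cases "u S < 0")
      case True
      then have "t \<le> w S / - u S" unfolding t_def using that N by (intro Min_le) (auto simp: N_def)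
      then show ?thesis using True by (simp add: w'_def field_simps)
    next
      case False
      then show ?thesis using \<open>t \<ge> 0\<close> w(1)[OF that] by (simp add: w'_def)
    qed
    have "w' S0 = 0" using S0 by (auto simp: w'_def N_def)
    have "(\<Sum>S\<in>\<Phi> - {S0}. w' S * indicator S i) = 1" if "i \<in> {1..d}" for i
    proof -
      have "(\<Sum>S\<in>\<Phi> - {S0}. w' S * indicator S i) = (\<Sum>S\<in>\<Phi>. w' S * indicator S i)"
        using \<open>w' S0 = 0\<close> fin by (intro sum.mono_neutral_left) auto
      also have "\<dots> = (\<Sum>S\<in>\<Phi>. w S * indicator S i) + t * (\<Sum>S\<in>\<Phi>. u S * indicator S i)"
        by (simp add: w'_def sum_distrib_left sum.distrib algebra_simps)
      finally show ?thesis using w(2) u that by simp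
    qed
    then have "balanced_family d (\<Phi> - {S0})"
      using w'_pos sub unfolding balanced_family_def by blast
    moreover have "\<Phi> - {S0} \<subset> \<Phi>" using S0 by (auto simp: N_def)
    ultimately show False using min by (auto simp: minimal_balanced_family_def)
  qed
  have "u S \<ge> 0" by (rule nonneg) fact+
  moreover have "- u S \<ge> 0"
    by (rule nonneg) (use u \<open>S \<in> \<Phi>\<close> in \<open>auto simp: sum_negf\<close>)
  ultimately show ?thesis by simp
qed

section \<open>Partition into closed sets\<close>

text \<open>The closed sets are the unions of connected components, expressed without paths.\<close>

definition closed_under :: "'a set set \<Rightarrow> 'a set \<Rightarrow> bool" where
  "closed_under E U \<longleftrightarrow> (\<forall>S\<in>E. S \<inter> U \<noteq> {} \<longrightarrow> S \<subseteq> U)"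

text \<open>Blocks are split off one by one. The rest \<open>U - J\<close> stays closed: an edge
  meeting it lies in \<open>U\<close> and cannot meet \<open>J\<close>, as it would then lie inside
  \<open>J\<close>.\<close>

lemma closed_under_partition:
  assumes "finite U" "closed_under E U"
    and block: "\<And>W. W \<subseteq> U \<Longrightarrow> W \<noteq> {} \<Longrightarrow> closed_under E W \<Longrightarrow>
      \<exists>I. I \<noteq> {} \<and> I \<subseteq> W \<and> closed_under E I \<and> P I"
  shows "\<exists>(k::nat) I. disjoint_family_on I {1..k} \<and> U = (\<Union>l\<in>{1..k}. I l) \<and>
      (\<forall>l\<in>{1..k}. closed_under E (I l) \<and> P (I l))"
  using assms
proof (induction U rule: finite_psubset_induct)
  case (psubset U)
  show ?case
  proof (cases "U = {}")
    case True
    then show ?thesis by (intro exI[of _ 0]) (auto simp: disjoint_family_on_def)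
  next
    case False
    then obtain J where J: "J \<noteq> {}" "J \<subseteq> U" "closed_under E J" "P J"
      using psubset.prems by blast
    have "U - J \<subset> U" using J by blast
    moreover have "closed_under E (U - J)"
      using psubset.prems(1) J(3) by (force simp: closed_under_def)
    moreover have "\<exists>I. I \<noteq> {} \<and> I \<subseteq> W \<and> closed_under E I \<and> P I"
      if "W \<subseteq> U - J" "W \<noteq> {}" "closed_under E W" for W
      using that by (intro psubset.prems(2)) auto
    ultimately have "\<exists>(k::nat) I. disjoint_family_on I {1..k} \<and> U - J = (\<Union>l\<in>{1..k}. I l) \<and>
        (\<forall>l\<in>{1..k}. closed_under E (I l) \<and> P (I l))"
      by (rule psubset.IH)
    then obtain k I where I: "disjoint_family_on I {1..k::nat}"
      "U - J = (\<Union>l\<in>{1..k}. I l)" "\<forall>l\<in>{1..k}. closed_under E (I l) \<and> P (I l)"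
      by blast
    let ?I = "I(Suc k := J)"
    have eq: "{1..Suc k} = insert (Suc k) {1..k}" by auto
    have Un: "(\<Union>l\<in>{1..k}. ?I l) = U - J"
      unfolding I(2) by (intro SUP_cong) auto
    have "disjoint_family_on ?I {1..k}"
      using I(1) by (simp add: disjoint_family_on_def)
    then have "disjoint_family_on ?I {1..Suc k}"
      unfolding eq using Un by (subst disjoint_family_on_insert) auto
    moreover have "U = (\<Union>l\<in>{1..Suc k}. ?I l)"
      unfolding eq UN_insert Un using J(2) by auto
    moreover have "\<forall>l\<in>{1..Suc k}. closed_under E (?I l) \<and> P (?I l)"
      using I(3) J unfolding eq by auto
    ultimately show ?thesis by blast
  qed
qed

section \<open>Cyclic and isolated blocks of a minimal balanced family\<close>

definition meeting :: "'a set set \<Rightarrow> 'a set \<Rightarrow> 'a set set" where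
  "meeting E I = {S \<in> E. S \<inter> I \<noteq> {}}"

text \<open>Stated for every nonempty closed \<open>W\<close>, so that blocks can be split off
  repeatedly. Closedness makes the edges meeting \<open>W\<close> a graph on \<open>W\<close> with
  the same vertex stars as \<open>\<Phi>\<close>.\<close>

lemma minimal_balanced_block:
  assumes pairs: "\<Phi> \<subseteq> nsets {1..d} 2" and min: "minimal_balanced_family d \<Phi>"
    and W: "W \<subseteq> {1..d}" "W \<noteq> {}" "closed_under \<Phi> W"
  shows "\<exists>I. I \<noteq> {} \<and> I \<subseteq> W \<and> closed_under \<Phi> I \<and>
    ((cyclic_family I (meeting \<Phi> I) \<and> odd (card (meeting \<Phi> I))) \<or>
      isolated_family I (meeting \<Phi> I))"
proof -
  have fin: "finite \<Phi>" using finite_subset[OF pairs] finite_imp_finite_nsets by blast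
  have fin_W: "finite W" using W(1) finite_subset by blast
  obtain w :: "nat set \<Rightarrow> real" where w: "\<And>S. S \<in> \<Phi> \<Longrightarrow> w S \<ge> 0"
      "\<And>i. i \<in> {1..d} \<Longrightarrow> (\<Sum>S\<in>\<Phi>. w S * indicator S i) = 1"
    using min unfolding minimal_balanced_family_def balanced_family_def by blast
  note kernel = minimal_balanced_kernel_trivial[OF min w]
  have w_star: "(\<Sum>S\<in>{S \<in> \<Phi>. i \<in> S}. w S) = 1" if "i \<in> {1..d}" for i
  proof -
    have "(\<Sum>S\<in>{S \<in> \<Phi>. i \<in> S}. w S) = (\<Sum>S\<in>\<Phi>. w S * indicator S i)"
      using fin by (intro sum.mono_neutral_cong_left) (auto simp: indicator_def)
    then show ?thesis using w(2)[OF that] by simp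
  qed
  have w_pos: "w S > 0" if "S \<in> \<Phi>" for S
  proof (rule ccontr)
    assume "\<not> w S > 0"
    then have "w S = 0" using w(1)[OF that] by simp
    then have "(\<Sum>T\<in>\<Phi> - {S}. w T * indicator T i) = (\<Sum>T\<in>\<Phi>. w T * indicator T i)" for i
      using fin by (intro sum.mono_neutral_left) auto
    then have "\<forall>i\<in>{1..d}. (\<Sum>T\<in>\<Phi> - {S}. w T * indicator T i) = 1"
      using w(2) by simp
    moreover have "\<Phi> - {S} \<subseteq> Pow {1..d}" using pairs by (auto simp: nsets_def)
    moreover have "\<forall>T\<in>\<Phi> - {S}. w T \<ge> 0" using w(1) by blast
    ultimately have "balanced_family d (\<Phi> - {S})"
      unfolding balanced_family_def by blast
    moreover have "\<Phi> - {S} \<subset> \<Phi>" using that by blast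
    ultimately show False using min by (auto simp: minimal_balanced_family_def)
  qed
  define E where "E = meeting \<Phi> W"
  have E: "E \<subseteq> nsets W 2" "E \<subseteq> \<Phi>" "finite E"
    using pairs W fin by (auto simp: E_def meeting_def closed_under_def nsets_def)
  have star: "{S \<in> \<Phi>. i \<in> S} = {S \<in> E. i \<in> S}" if "i \<in> W" for i
    using that by (auto simp: E_def meeting_def)
  show ?thesis
  proof (cases "\<exists>S\<in>E. w S = 1")
    case True
    then obtain S where S: "S \<in> E" "w S = 1" by blast
    \<comment> \<open>A second edge at \<open>i\<close> has positive weight and would push the sum
      at \<open>i\<close> above 1.\<close>
    have uniq: "T = S" if T: "T \<in> \<Phi>" "i \<in> T" "i \<in> S" for T i
    proof (rule ccontr)
      assume "T \<noteq> S"
      have i: "i \<in> {1..d}" using T(2) subsetD[OF pairs T(1)] by (auto simp: nsets_def)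
      have "w T + w S = (\<Sum>R\<in>{T, S}. w R)" using \<open>T \<noteq> S\<close> by simp
      also have "\<dots> \<le> (\<Sum>R\<in>{R \<in> \<Phi>. i \<in> R}. w R)"
        using fin T S E w(1) by (intro sum_mono2) auto
      also have "\<dots> = 1" by (rule w_star[OF i])
      finally show False using w_pos[OF T(1)] S by simp
    qed
    have props: "finite S" "card S = 2" "S \<subseteq> W" "S \<noteq> {}"
      using S E by (auto simp: nsets_def)
    have "meeting \<Phi> S = {S}"
      using uniq S(1) E(2) props(4) unfolding meeting_def by blast
    moreover have "closed_under \<Phi> S"
      using uniq unfolding closed_under_def by blast
    ultimately show ?thesis using props unfolding isolated_family_def by blast
  next
    case False
    \<comment> \<open>No edge at \<open>i\<close> would give weight sum 0, and a single edge would
      have weight 1, which this case excludes.\<close>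
    have deg_ge: "2 \<le> card {S \<in> E. i \<in> S}" if "i \<in> W" for i
    proof (rule ccontr)
      let ?D = "{S \<in> E. i \<in> S}"
      have sum: "(\<Sum>S\<in>?D. w S) = 1" using w_star[of i] that W(1) unfolding star[OF that] by blast
      assume "\<not> 2 \<le> card ?D"
      then consider "card ?D = 0" | "card ?D = 1" by linarith
      then show False
      proof cases
        case 1
        moreover have "finite ?D" using E(3) by simp
        ultimately have D: "?D = {}" by (simp only: card_eq_0_iff) blast
        show ?thesis using sum unfolding D by simp
      next
        case 2
        then obtain S where S: "?D = {S}" by (rule card_1_singletonE)
        have "w S = 1" using sum unfolding S by simp
        then show ?thesis using S False by blast
      qed
    qed
    have "card E \<le> card W"
    proof (rule ccontr)
      assume "\<not> card E \<le> card W"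
      then obtain u where u: "\<exists>S\<in>E. u S \<noteq> (0::real)"
        "\<And>i. i \<in> W \<Longrightarrow> (\<Sum>S\<in>E. indicator S i * u S) = 0"
        using underdetermined_system[OF fin_W E(3), of "\<lambda>i S. indicator S i"] by auto
      \<comment> \<open>Extension by 0 stays in the kernel, because no edge of \<open>E\<close>
        contains a point outside \<open>W\<close>.\<close>
      define u' where "u' S = (if S \<in> E then u S else 0)" for S
      have "(\<Sum>S\<in>\<Phi>. u' S * indicator S i) = 0" for i
      proof -
        have "(\<Sum>S\<in>\<Phi>. u' S * indicator S i) = (\<Sum>S\<in>E. indicator S i * u S)"
          using E fin by (intro sum.mono_neutral_cong_right) (auto simp: u'_def)
        also have "\<dots> = 0"
        proof (cases "i \<in> W")
          case False
          then show ?thesis using E(1) by (intro sum.neutral) (auto simp: nsets_def indicator_def)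
        qed (rule u(2))
        finally show ?thesis .
      qed
      then have "u' S = 0" if "S \<in> \<Phi>" for S using kernel[of u' S] that by simp
      then show False using u(1) E(2) by (force simp: u'_def)
    qed
    \<comment> \<open>Double counting: the degrees sum to \<open>2 * card E\<close>, hence to at
      most \<open>2 * card W\<close>, while each of them is at least 2.\<close>
    have deg: "card {S \<in> E. i \<in> S} = 2" if "i \<in> W" for i
    proof (rule ccontr)
      assume ne: "card {S \<in> E. i \<in> S} \<noteq> 2"
      have "\<forall>S\<in>E. card {j \<in> W. j \<in> S} = 2"
      proof
        fix S assume "S \<in> E"
        then have "{j \<in> W. j \<in> S} = S" "card S = 2" using E(1) by (auto simp: nsets_def)
        then show "card {j \<in> W. j \<in> S} = 2" by simp
      qed
      then have "(\<Sum>j\<in>W. card {S \<in> E. j \<in> S}) = 2 * card E"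
        by (rule sum_multicount[OF fin_W E(3)])
      moreover have "(\<Sum>j\<in>W. 2) < (\<Sum>j\<in>W. card {S \<in> E. j \<in> S})"
        using that ne deg_ge
        by (intro sum_strict_mono_ex1[OF fin_W])
          (auto intro!: bexI[of _ i] simp: less_le)
      ultimately show False using \<open>card E \<le> card W\<close> by simp
    qed
    obtain v where "v \<in> W" using W by blast
    obtain n f where f: "n \<ge> 3" "f n = f 0" "inj_on f {..<n}" "f ` {..<n} \<subseteq> W"
      "inj_on (\<lambda>j. {f j, f (Suc j)}) {..<n}"
      "{S \<in> E. S \<inter> f ` {..<n} \<noteq> {}} = (\<lambda>j. {f j, f (Suc j)}) ` {..<n}"
      by (rule two_regular_cycle[OF fin_W E(1) deg \<open>v \<in> W\<close>])
    define I where "I = f ` {..<n}"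
    define F where "F = (\<lambda>j. {f j, f (Suc j)}) ` {..<n}"
    \<comment> \<open>As \<open>I\<close> lies in \<open>W\<close>, every edge of
      \<open>\<Phi>\<close> that meets \<open>I\<close> already belongs to \<open>E\<close>.\<close>
    have F: "meeting \<Phi> I = F"
      using f(4,6) by (auto simp: F_def I_def E_def meeting_def)
    have "card F = n" using f(5) by (simp add: F_def card_image)
    have "odd n"
    proof
      assume "even n"
      have sub: "(\<lambda>j. {f j, f (Suc j)}) ` {..<n} \<subseteq> \<Phi>"
        using F by (auto simp: F_def meeting_def)
      have neq: "f (Suc j) \<noteq> f j" if "j < n" for j
      proof -
        have "{f j, f (Suc j)} \<in> nsets {1..d} 2" using sub pairs that by blast
        then show ?thesis by (auto simp: nsets_def)
      qed
      obtain u :: "nat set \<Rightarrow> real" where "\<exists>S\<in>\<Phi>. u S \<noteq> 0"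
        "\<And>i. (\<Sum>S\<in>\<Phi>. u S * indicator S i) = 0"
        using even_cycle_alternating_weights[OF fin \<open>even n\<close> _ f(2) neq f(5) sub] f(1) by auto
      then show False using kernel by blast
    qed
    have "f (Suc j) \<in> I" if "j < n" for j
      using that f(1,2) by (cases "Suc j = n") (auto simp: I_def)
    then have "S \<subseteq> I" if "S \<in> F" for S
      using that by (auto simp: F_def I_def)
    then have "closed_under \<Phi> I"
      using F by (auto simp: closed_under_def meeting_def)
    moreover have "I \<noteq> {}" using f(1) by (auto simp: I_def lessThan_empty_iff)
    moreover have "cyclic_family I F"
      unfolding I_def F_def by (rule cyclic_family_closed_walk) fact+
    moreover have "I \<subseteq> W" using f(4) by (simp add: I_def)
    ultimately show ?thesis
      using F \<open>card F = n\<close> \<open>odd n\<close> by (intro exI[of _ I]) simp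
  qed
qed

theorem theorem1:
  fixes d :: nat and \<Phi> :: "nat set set"
  assumes "d \<ge> 1"
    and "\<Phi> \<subseteq> nsets {1..d} 2"
    and "minimal_balanced_family d \<Phi>"
  shows "\<exists>(k::nat) (I :: nat \<Rightarrow> nat set) (\<Phi>' :: nat \<Rightarrow> nat set set).
           disjoint_family_on I {1..k} \<and>
           {1..d} = (\<Union>l\<in>{1..k}. I l) \<and>
           \<Phi> = (\<Union>l\<in>{1..k}. \<Phi>' l) \<and>
           (\<forall>l\<in>{1..k}. \<Phi>' l \<subseteq> nsets (I l) 2 \<and>
              ((cyclic_family (I l) (\<Phi>' l) \<and> odd (card (\<Phi>' l))) \<or>
               isolated_family (I l) (\<Phi>' l)))"
proof -
  define P where "P I \<longleftrightarrow> (cyclic_family I (meeting \<Phi> I) \<and> odd (card (meeting \<Phi> I))) \<or>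
      isolated_family I (meeting \<Phi> I)" for I
  have block: "\<exists>I. I \<noteq> {} \<and> I \<subseteq> W \<and> closed_under \<Phi> I \<and> P I"
    if "W \<subseteq> {1..d}" "W \<noteq> {}" "closed_under \<Phi> W" for W
    unfolding P_def by (rule minimal_balanced_block[OF assms(2,3) that])
  have "closed_under \<Phi> {1..d}"
    using assms(2) by (auto simp: closed_under_def nsets_def)
  note partition = closed_under_partition[of "{1..d}" \<Phi> P, OF finite_atLeastAtMost this]
  have "\<exists>(k::nat) I. disjoint_family_on I {1..k} \<and> {1..d} = (\<Union>l\<in>{1..k}. I l) \<and>
      (\<forall>l\<in>{1..k}. closed_under \<Phi> (I l) \<and> P (I l))"
    by (rule partition) (rule block)
  then obtain k :: nat and I where I: "disjoint_family_on I {1..k}"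
    "{1..d} = (\<Union>l\<in>{1..k}. I l)" "\<forall>l\<in>{1..k}. closed_under \<Phi> (I l) \<and> P (I l)"
    by (elim exE conjE)
  \<comment> \<open>Each edge has a vertex in some block; closedness of that block later puts the
    whole edge inside it.\<close>
  have "\<Phi> = (\<Union>l\<in>{1..k}. meeting \<Phi> (I l))"
  proof
    show "\<Phi> \<subseteq> (\<Union>l\<in>{1..k}. meeting \<Phi> (I l))"
    proof
      fix S assume S: "S \<in> \<Phi>"
      then have "S \<noteq> {}" "S \<subseteq> {1..d}" using assms(2) by (auto simp: nsets_def)
      then obtain x where "x \<in> S" "x \<in> {1..d}" by blast
      then obtain l where "l \<in> {1..k}" "x \<in> I l" using I(2) by blast
      then show "S \<in> (\<Union>l\<in>{1..k}. meeting \<Phi> (I l))"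
        using S \<open>x \<in> S\<close> by (auto simp: meeting_def)
    qed
  qed (auto simp: meeting_def)
  moreover have "meeting \<Phi> (I l) \<subseteq> nsets (I l) 2" if "l \<in> {1..k}" for l
  proof -
    have "closed_under \<Phi> (I l)" using I(3) that by blast
    then show ?thesis using assms(2) by (auto simp: meeting_def closed_under_def nsets_def)
  qed
  ultimately show ?thesis
    using I(1,2) I(3)[unfolded P_def]
    by (intro exI[of _ k] exI[of _ I] exI[of _ "\<lambda>l. meeting \<Phi> (I l)"] conjI ballI) simp_all
qed

end
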